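(* Let $H=(h_{jt})\in\mathbb{R}^{n\times k}$ be a candidate matrix and $\mathbf{w}\in\mathbb{R}^k$ a query vector, and let $Z=H\,\mathrm{diag}(\mathbf{w})$, i.e. $z_{jt}=h_{jt}w_t$ for $j=1,\ldots,n$, $t=1,\ldots,k$. Define the greedy ranking $\bar{\pi}(j\mid\mathbf{w}) := \mathrm{rank}\big(\max_{t=1}^k z_{jt} \,\big|\, \{\max_{t=1}^k z_{1t},\ldots,\max_{t=1}^k z_{nt}\}\big)$ and the joint ranking $\pi(j,t\mid\mathbf{w}) := \mathrm{rank}\big(z_{jt}\mid\{z_{11},\ldots,z_{nk}\}\big)$. Suppose the $nk$ pairs $(j,t)$ are visited one at a time in a sequence induced by the joint ranking, i.e. $(j,t)$ is visited before $(j',t')$ whenever $z_{jt}>z_{j't'}$, and that a list $\mathcal{C}(\mathbf{w})$, initially empty, is built by appending $j$ to $\mathcal{C}(\mathbf{w})$ each time a pair $(j,t)$ is visited with $j\notin\mathcal{C}(\mathbf{w})$. Then for all $j_1,j_2\in\{1,\ldots,n\}$ with $\bar{\pi}(j_1\mid\mathbf{w})<\bar{\pi}(j_2\mid\mathbf{w})$, the index $j_1$ is included into $\mathcal{C}(\mathbf{w})$ before $j_2$.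
   Context: For a finite multiset of reals $\mathcal{X}=\{x_1,\ldots,x_{|\mathcal{X}|}\}$ and an item $x$, $\mathrm{rank}(x\mid\mathcal{X}) := \sum_{j=1}^{|\mathcal{X}|}\mathbb{1}[x_j\ge x]$, where $\mathbb{1}[\cdot]$ is the indicator function. $\mathrm{diag}(\mathbf{w})$ is the $k\times k$ diagonal matrix with diagonal $\mathbf{w}$. *)

theory Defs
  imports "HOL-Analysis.Determinants" "HOL-Library.Multiset"
begin

(* The number of items of X that are at least x, with multiplicity. The name avoids
   the linear-algebraic constant rank of HOL-Analysis. *)
definition rank_in :: "real \<Rightarrow> real multiset \<Rightarrow> nat" where
  "rank_in x X = (\<Sum>y\<in>#X. of_bool (y \<ge> x))"

definition diag :: "real ^ 'k \<Rightarrow> real ^ 'k ^ 'k" where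
  "diag w = (\<chi> s t. if s = t then w $ s else 0)"

(* Rows are indexed by candidates and columns by coordinates. *)
definition score :: "real ^ 'k ^ 'n \<Rightarrow> real ^ 'k \<Rightarrow> real ^ 'k ^ 'n" where
  "score H w = H ** diag w"

lemma score_nth: "score H w $ j $ t = H $ j $ t * w $ t"
  by (simp add: score_def matrix_matrix_mult_def diag_def if_distrib cong: if_cong)

definition max_score :: "real ^ 'k ^ 'n \<Rightarrow> real ^ 'k \<Rightarrow> 'n \<Rightarrow> real" where
  "max_score H w j = Max (range (\<lambda>t. score H w $ j $ t))"

definition greedy_ranking :: "real ^ 'k ^ 'n \<Rightarrow> real ^ 'k \<Rightarrow> 'n \<Rightarrow> nat" where
  "greedy_ranking H w j =
     rank_in (max_score H w j) {# max_score H w i. i \<in># mset_set UNIV #}"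

definition joint_ranking :: "real ^ 'k ^ 'n \<Rightarrow> real ^ 'k \<Rightarrow> 'n \<Rightarrow> 'k \<Rightarrow> nat" where
  "joint_ranking H w j t =
     rank_in (score H w $ j $ t) {# score H w $ i $ s. (i, s) \<in># mset_set UNIV #}"

definition precedes :: "'a list \<Rightarrow> 'a \<Rightarrow> 'a \<Rightarrow> bool" where
  "precedes xs x y \<longleftrightarrow> (\<exists>a b. a < b \<and> b < length xs \<and> xs ! a = x \<and> xs ! b = y)"

(* Every pair is visited exactly once, and ties may be broken arbitrarily. By
   joint_ranking_less_iff below, the last conjunct says that pairs with a smaller joint
   ranking come first. *)
definition visiting_sequence :: "real ^ 'k ^ 'n \<Rightarrow> real ^ 'k \<Rightarrow> ('n \<times> 'k) list \<Rightarrow> bool" where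
  "visiting_sequence H w vs \<longleftrightarrow>
     distinct vs \<and> set vs = UNIV \<and>
     (\<forall>j t j' t'. score H w $ j $ t > score H w $ j' $ t' \<longrightarrow> precedes vs (j, t) (j', t'))"

lemma joint_ranking_less_iff:
  "joint_ranking H w j t < joint_ranking H w j' t' \<longleftrightarrow>
     score H w $ j $ t > score H w $ j' $ t'"
proof -
  let ?z = "\<lambda>p. score H w $ fst p $ snd p"
  have rank: "joint_ranking H w i s = card {p. ?z p \<ge> ?z (i, s)}" for i s
    by (simp add: joint_ranking_def rank_in_def image_mset.compositionality o_def
        case_prod_unfold sum_unfold_sum_mset[symmetric] sum.If_cases of_bool_def)
  have mono: "joint_ranking H w i s \<le> joint_ranking H w i' s'"
    if "?z (i, s) \<ge> ?z (i', s')" for i s i' s'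
    unfolding rank using that by (intro card_mono) auto
  have strict: "joint_ranking H w i s < joint_ranking H w i' s'"
    if "?z (i, s) > ?z (i', s')" for i s i' s'
  proof -
    have "(i', s') \<in> {p. ?z p \<ge> ?z (i', s')} - {p. ?z p \<ge> ?z (i, s)}"
      using that by auto
    moreover have "{p. ?z p \<ge> ?z (i, s)} \<subseteq> {p. ?z p \<ge> ?z (i', s')}"
      using that by auto
    ultimately have "{p. ?z p \<ge> ?z (i, s)} \<subset> {p. ?z p \<ge> ?z (i', s')}"
      by blast
    then show ?thesis
      unfolding rank by (intro psubset_card_mono) auto
  qed
  show ?thesis
    using mono[of j' t' j t] strict[of j' t' j t] strict[of j t j' t'] mono[of j t j' t'] by force
qed

(* The list after all visits in vs, processed from left to right. *)
definition candidates :: "('n \<times> 'k) list \<Rightarrow> 'n list" where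
  "candidates vs = foldl (\<lambda>C (j, t). if j \<in> set C then C else C @ [j]) [] vs"

end

theory Submission
  imports Defs
begin

(* Say j1 has the larger maximal score. Its best pair then beats every pair of j2, so it has been
   visited, and j1 included, by the time the first pair of j2 is visited. *)

text \<open>Cut the visits just before the first pair of \<open>j\<^sub>2\<close>. The candidates of
  the part before the cut include \<open>j\<^sub>1\<close> but not \<open>j\<^sub>2\<close>
  (\<open>precedes_distinct_split\<close>, \<open>set_candidates\<close>). Later visits only extend
  this list at its end (\<open>candidates_append\<close>), so \<open>j\<^sub>2\<close> lands behind
  \<open>j\<^sub>1\<close>.\<close>

lemma rank_in_antimono: "x \<le> y \<Longrightarrow> rank_in y X \<le> rank_in x X"
  unfolding rank_in_def by (intro sum_mset_mono) auto

lemma set_candidates: "set (candidates vs) = fst ` set vs"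
proof (induction vs rule: rev_induct)
  case (snoc p vs)
  then show ?case
    by (cases p) (auto simp: candidates_def)
qed (simp add: candidates_def)

lemma candidates_append: "\<exists>zs. candidates (us @ vs) = candidates us @ zs"
proof (induction vs rule: rev_induct)
  case (snoc p vs)
  then show ?case
    by (cases p) (auto simp: candidates_def)
qed simp

lemma precedes_append: "x \<in> set xs \<Longrightarrow> y \<in> set ys \<Longrightarrow> precedes (xs @ ys) x y"
proof -
  assume "x \<in> set xs" "y \<in> set ys"
  then obtain a b where "a < length xs" "xs ! a = x" "b < length ys" "ys ! b = y"
    by (auto simp: in_set_conv_nth)
  then show ?thesis
    unfolding precedes_def
    by (intro exI[of _ a] exI[of _ "length xs + b"]) (auto simp: nth_append)
qed

text \<open>Distinctness leaves \<open>length us\<close> as the only position of \<open>y\<close>,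
  so the smaller index of \<open>x\<close> must fall inside \<open>us\<close>.\<close>

lemma precedes_distinct_split:
  assumes "precedes (us @ y # ws) x y" "distinct (us @ y # ws)"
  shows "x \<in> set us"
proof -
  obtain a b where ab: "a < b" "b < length (us @ y # ws)"
      "(us @ y # ws) ! a = x" "(us @ y # ws) ! b = y"
    using assms(1) unfolding precedes_def by blast
  have "b = length us"
    using nth_eq_iff_index_eq[OF assms(2) ab(2), of "length us"] ab(4) by simp
  then show ?thesis
    using ab by (auto simp: nth_append)
qed

theorem theorem1:
  fixes H :: "real ^ 'k ^ 'n" and w :: "real ^ 'k"
    and vs :: "('n \<times> 'k) list" and j\<^sub>1 j\<^sub>2 :: 'n
  assumes "visiting_sequence H w vs"
    and "greedy_ranking H w j\<^sub>1 < greedy_ranking H w j\<^sub>2"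
  shows "precedes (candidates vs) j\<^sub>1 j\<^sub>2"
proof -
  have vs: "distinct vs" "set vs = UNIV"
    and order: "\<And>j t j' t'. score H w $ j $ t > score H w $ j' $ t' \<Longrightarrow>
      precedes vs (j, t) (j', t')"
    using assms(1) unfolding visiting_sequence_def by auto
  \<comment> \<open>Both rankings count in the same multiset, so by the contrapositive of
    \<open>rank_in_antimono\<close> a smaller rank forces a strictly larger value.\<close>
  have max_less: "max_score H w j\<^sub>2 < max_score H w j\<^sub>1"
    using assms(2) unfolding greedy_ranking_def by (meson leD not_le rank_in_antimono)
  have "max_score H w j\<^sub>1 \<in> range (\<lambda>t. score H w $ j\<^sub>1 $ t)"
    unfolding max_score_def by (intro Max_in) auto
  then obtain t where t: "max_score H w j\<^sub>1 = score H w $ j\<^sub>1 $ t"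
    by blast
  have "\<exists>p \<in> set vs. fst p = j\<^sub>2"
    by (simp add: vs)
  then obtain us p ws where split: "vs = us @ p # ws" "fst p = j\<^sub>2"
      and fresh: "\<forall>q \<in> set us. fst q \<noteq> j\<^sub>2"
    by (rule split_list_first_propE)
  then obtain s where p: "p = (j\<^sub>2, s)"
    by (cases p) auto
  \<comment> \<open>The first visited pair of \<open>j\<^sub>2\<close> need not be known to attain
    its maximum; the upper bound is enough to put it strictly below
    \<open>(j\<^sub>1, t)\<close>.\<close>
  have "score H w $ j\<^sub>2 $ s \<le> max_score H w j\<^sub>2"
    unfolding max_score_def by (intro Max_ge) auto
  then have "precedes vs (j\<^sub>1, t) p"
    unfolding p using max_less t by (intro order) simp
  then have "(j\<^sub>1, t) \<in> set us"
    using vs(1) unfolding split(1) by (rule precedes_distinct_split)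
  then have "j\<^sub>1 \<in> set (candidates us)"
    unfolding set_candidates by force
  moreover obtain zs where zs: "candidates vs = candidates us @ zs"
    using candidates_append split(1) by blast
  \<comment> \<open>No pair of \<open>j\<^sub>2\<close> occurs in \<open>us\<close>, so its entry
    can only come from the extension \<open>zs\<close>.\<close>
  moreover have "j\<^sub>2 \<in> set zs"
  proof -
    have "j\<^sub>2 \<in> set (candidates vs)" "j\<^sub>2 \<notin> set (candidates us)"
      using split fresh by (auto simp: set_candidates)
    then show ?thesis
      using zs by simp
  qed
  ultimately show ?thesis
    by (simp add: precedes_append)
qed

end
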